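(* For every formula $\phi$, both $\bot\to\phi$ (ex contradictione quodlibet) and $\phi\to\top$ are theorems of the propositional proof system IRL defined in the context.
   Context: Language: formulas are built from a countable set $K$ of primitive propositions using the connectives $\top,\bot$ (nullary), $\neg$ (unary), $\wedge,\vee,\leftrightarrow,\to$ (binary, all syntactically independent symbols). $\neg$ binds strongest, and $\wedge,\vee$ bind more strongly than $\to,\leftrightarrow$. Schematic letters $\phi,\psi,\chi$ range over all formulas. Axiom schemas of IRL: $\phi\leftrightarrow\phi$; $\phi\wedge\psi\leftrightarrow\psi\wedge\phi$; $\phi\vee\psi\leftrightarrow\psi\vee\phi$; $(\phi\wedge\psi)\wedge\chi\leftrightarrow\phi\wedge(\psi\wedge\chi)$; $(\phi\vee\psi)\vee\chi\leftrightarrow\phi\vee(\psi\vee\chi)$; $\phi\wedge(\psi\vee\chi)\leftrightarrow(\phi\wedge\psi)\vee(\phi\wedge\chi)$; $\phi\vee(\psi\wedge\chi)\leftrightarrow(\phi\vee\psi)\wedge(\phi\vee\chi)$; $\phi\wedge\top\leftrightarrow\phi$; $\phi\vee\bot\leftrightarrow\phi$; $\phi\wedge\neg\phi\leftrightarrow\bot$; $\phi\vee\neg\phi\leftrightarrow\top$; $(\phi\to\psi)\leftrightarrow(\phi\wedge\psi\leftrightarrow\phi)$. Primitive rules of IRL: (R1) from $\phi,\psi$ infer $\phi\wedge\psi$; (R2) from $\phi\wedge\psi$ infer $\phi$; (R3) from $\phi\leftrightarrow\psi$ and $\chi$ infer $\chi[\phi\mapsto\psi]$, where $\chi[\phi\mapsto\psi]$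 is any formula obtained from $\chi$ by replacing one or more arbitrarily selected occurrences of the subformula $\phi$ by $\psi$; (R4, conditional proof) if $\{\phi\}\vdash\psi$ then $\vdash\phi\to\psi$. Derivations: for a finite set $X$ of formulas, $X\vdash y$ means there is a finite sequence of formulas ending in $y$, each member of which is a theorem or results from members of $X$ and earlier members of the sequence by R1, R2 or R3. A theorem is a formula $y$ with $\emptyset\vdash y$ (written $\vdash y$); axioms are theorems, and formulas $\phi\to\psi$ obtained by R4 are theorems. R4 applies only to derivations with the single premise $\phi$ and no other undischarged premises. *)

theory Defs
  imports "HOL-Library.Countable"
begin

datatype 'k fm =
    Prim 'k
  | Top  ("\<^bold>\<top>")
  | Bot  ("\<^bold>\<bottom>")
  | Neg "'k fm"  ("\<^bold>\<not> _" [90] 90)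
  | Conj "'k fm" "'k fm"  (infixr "\<^bold>\<and>" 80)
  | Disj "'k fm" "'k fm"  (infixr "\<^bold>\<or>" 80)
  | Iff "'k fm" "'k fm"  (infixr "\<^bold>\<leftrightarrow>" 70)
  | Imp "'k fm" "'k fm"  (infixr "\<^bold>\<rightarrow>" 70)

inductive irl_axiom :: "'k fm \<Rightarrow> bool" where
  "irl_axiom (\<phi> \<^bold>\<leftrightarrow> \<phi>)"
| "irl_axiom ((\<phi> \<^bold>\<and> \<psi>) \<^bold>\<leftrightarrow> (\<psi> \<^bold>\<and> \<phi>))"
| "irl_axiom ((\<phi> \<^bold>\<or> \<psi>) \<^bold>\<leftrightarrow> (\<psi> \<^bold>\<or> \<phi>))"
| "irl_axiom (((\<phi> \<^bold>\<and> \<psi>) \<^bold>\<and> \<chi>) \<^bold>\<leftrightarrow> (\<phi> \<^bold>\<and> (\<psi> \<^bold>\<and> \<chi>)))"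
| "irl_axiom (((\<phi> \<^bold>\<or> \<psi>) \<^bold>\<or> \<chi>) \<^bold>\<leftrightarrow> (\<phi> \<^bold>\<or> (\<psi> \<^bold>\<or> \<chi>)))"
| "irl_axiom ((\<phi> \<^bold>\<and> (\<psi> \<^bold>\<or> \<chi>)) \<^bold>\<leftrightarrow> ((\<phi> \<^bold>\<and> \<psi>) \<^bold>\<or> (\<phi> \<^bold>\<and> \<chi>)))"
| "irl_axiom ((\<phi> \<^bold>\<or> (\<psi> \<^bold>\<and> \<chi>)) \<^bold>\<leftrightarrow> ((\<phi> \<^bold>\<or> \<psi>) \<^bold>\<and> (\<phi> \<^bold>\<or> \<chi>)))"
| "irl_axiom ((\<phi> \<^bold>\<and> \<^bold>\<top>) \<^bold>\<leftrightarrow> \<phi>)"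
| "irl_axiom ((\<phi> \<^bold>\<or> \<^bold>\<bottom>) \<^bold>\<leftrightarrow> \<phi>)"
| "irl_axiom ((\<phi> \<^bold>\<and> \<^bold>\<not> \<phi>) \<^bold>\<leftrightarrow> \<^bold>\<bottom>)"
| "irl_axiom ((\<phi> \<^bold>\<or> \<^bold>\<not> \<phi>) \<^bold>\<leftrightarrow> \<^bold>\<top>)"
| "irl_axiom ((\<phi> \<^bold>\<rightarrow> \<psi>) \<^bold>\<leftrightarrow> ((\<phi> \<^bold>\<and> \<psi>) \<^bold>\<leftrightarrow> \<phi>))"

text \<open>\<open>repl \<phi> \<psi> n \<chi> \<chi>'\<close>: the formula \<open>\<chi>'\<close> arises from \<open>\<chi>\<close> by replacing
  \<open>n\<close> selected occurrences of the subformula \<open>\<phi>\<close> by \<open>\<psi>\<close>; the other occurrences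
  of \<open>\<phi>\<close> are left in place.\<close>

inductive repl :: "'k fm \<Rightarrow> 'k fm \<Rightarrow> nat \<Rightarrow> 'k fm \<Rightarrow> 'k fm \<Rightarrow> bool" for \<phi> \<psi> where
  keep: "repl \<phi> \<psi> 0 \<chi> \<chi>"
| here: "repl \<phi> \<psi> 1 \<phi> \<psi>"
| neg:  "repl \<phi> \<psi> n a a' \<Longrightarrow> repl \<phi> \<psi> n (\<^bold>\<not> a) (\<^bold>\<not> a')"
| conj: "repl \<phi> \<psi> m a a' \<Longrightarrow> repl \<phi> \<psi> n b b' \<Longrightarrow> repl \<phi> \<psi> (m + n) (a \<^bold>\<and> b) (a' \<^bold>\<and> b')"
| disj: "repl \<phi> \<psi> m a a' \<Longrightarrow> repl \<phi> \<psi> n b b' \<Longrightarrow> repl \<phi> \<psi> (m + n) (a \<^bold>\<or> b) (a' \<^bold>\<or> b')"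
| iff:  "repl \<phi> \<psi> m a a' \<Longrightarrow> repl \<phi> \<psi> n b b' \<Longrightarrow> repl \<phi> \<psi> (m + n) (a \<^bold>\<leftrightarrow> b) (a' \<^bold>\<leftrightarrow> b')"
| imp:  "repl \<phi> \<psi> m a a' \<Longrightarrow> repl \<phi> \<psi> n b b' \<Longrightarrow> repl \<phi> \<psi> (m + n) (a \<^bold>\<rightarrow> b) (a' \<^bold>\<rightarrow> b')"

inductive by_rule :: "'k fm set \<Rightarrow> 'k fm \<Rightarrow> bool" for S where
  R1: "\<phi> \<in> S \<Longrightarrow> \<psi> \<in> S \<Longrightarrow> by_rule S (\<phi> \<^bold>\<and> \<psi>)"
| R2: "\<phi> \<^bold>\<and> \<psi> \<in> S \<Longrightarrow> by_rule S \<phi>"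
| R3: "\<phi> \<^bold>\<leftrightarrow> \<psi> \<in> S \<Longrightarrow> \<chi> \<in> S \<Longrightarrow> n \<ge> 1 \<Longrightarrow> repl \<phi> \<psi> n \<chi> \<chi>' \<Longrightarrow> by_rule S \<chi>'"

text \<open>Derivability and theoremhood depend on each other (through conditional proof), so
  derivations are first defined relative to a predicate \<open>T\<close> that tells which formulas
  count as theorems; \<open>irl_thm\<close> is then the least predicate closed under the stated
  clauses.\<close>

definition deriv_from :: "('k fm \<Rightarrow> bool) \<Rightarrow> 'k fm set \<Rightarrow> 'k fm \<Rightarrow> bool" where
  "deriv_from T X y \<longleftrightarrow>
     (\<exists>ys. ys \<noteq> [] \<and> last ys = y \<and>
        (\<forall>i < length ys. T (ys ! i) \<or> by_rule (X \<union> set (take i ys)) (ys ! i)))"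

lemma deriv_from_mono [mono]: "T \<le> T' \<Longrightarrow> deriv_from T X y \<longrightarrow> deriv_from T' X y"
  unfolding deriv_from_def by blast

inductive irl_thm :: "'k fm \<Rightarrow> bool" where
  ax: "irl_axiom y \<Longrightarrow> irl_thm y"
| derived: "deriv_from irl_thm {} y \<Longrightarrow> irl_thm y"
| R4: "deriv_from irl_thm {\<phi>} \<psi> \<Longrightarrow> irl_thm (\<phi> \<^bold>\<rightarrow> \<psi>)"

definition derives :: "'k fm set \<Rightarrow> 'k fm \<Rightarrow> bool"  (infix "\<turnstile>" 55) where
  "X \<turnstile> y \<longleftrightarrow> finite X \<and> deriv_from irl_thm X y"

lemma irl_thm_imp_derives: "irl_thm y \<Longrightarrow> finite X \<Longrightarrow> X \<turnstile> y"
  unfolding derives_def deriv_from_def by (intro conjI exI[of _ "[y]"]) auto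

lemma irl_thm_iff: "irl_thm y \<longleftrightarrow> {} \<turnstile> y"
  using irl_thm_imp_derives irl_thm.derived by (auto simp: derives_def)

text \<open>Premises need no clause of their own in a derivation: apply R3 to
  \<open>\<phi> \<^bold>\<leftrightarrow> \<phi>\<close> and the premise \<open>\<phi>\<close>.\<close>

lemma premise_derives: "finite X \<Longrightarrow> \<phi> \<in> X \<Longrightarrow> X \<turnstile> \<phi>"
  unfolding derives_def deriv_from_def
  by (intro conjI exI[of _ "[\<phi> \<^bold>\<leftrightarrow> \<phi>, \<phi>]"])
    (auto simp: less_Suc_eq intro: irl_thm.ax irl_axiom.intros by_rule.R3[OF _ _ _ repl.here])

end

theory Submission
  imports Defs
begin

text \<open>By the axiom for \<open>\<rightarrow>\<close>, the two claims amount to \<open>\<^bold>\<bottom> \<^bold>\<and> \<phi> \<^bold>\<leftrightarrow> \<^bold>\<bottom>\<close> and to the axiom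
  \<open>\<phi> \<^bold>\<and> \<^bold>\<top> \<^bold>\<leftrightarrow> \<phi>\<close>. The first is the Boolean computation
  \<open>\<phi> \<^bold>\<and> \<^bold>\<bottom> = (\<phi> \<^bold>\<and> \<^bold>\<bottom>) \<^bold>\<or> \<^bold>\<bottom> = (\<phi> \<^bold>\<and> \<^bold>\<bottom>) \<^bold>\<or> (\<phi> \<^bold>\<and> \<^bold>\<not> \<phi>) = \<phi> \<^bold>\<and> (\<^bold>\<bottom> \<^bold>\<or> \<^bold>\<not> \<phi>) = \<phi> \<^bold>\<and> \<^bold>\<not> \<phi> = \<^bold>\<bottom>\<close>.\<close>

text \<open>R3 lifts to theorems: the three-member sequence consisting of the equivalence,
  \<open>\<chi>\<close> and \<open>\<chi>'\<close> is a derivation without premises, its first two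
  members being theorems.\<close>

lemma irl_thm_replace:
  assumes "irl_thm (\<phi> \<^bold>\<leftrightarrow> \<psi>)" "irl_thm \<chi>" "repl \<phi> \<psi> n \<chi> \<chi>'" "n \<ge> 1"
  shows "irl_thm \<chi>'"
proof (rule irl_thm.derived)
  have "by_rule {\<phi> \<^bold>\<leftrightarrow> \<psi>, \<chi>} \<chi>'"
    using assms(3,4) by (intro by_rule.R3[of \<phi> \<psi> _ \<chi>]) auto
  then show "deriv_from irl_thm {} \<chi>'"
    unfolding deriv_from_def using assms(1,2)
    by (intro exI[of _ "[\<phi> \<^bold>\<leftrightarrow> \<psi>, \<chi>, \<chi>']"]) (auto simp: less_Suc_eq)
qed

lemma irl_thm_iff_mp:
  assumes "irl_thm (\<phi> \<^bold>\<leftrightarrow> \<psi>)" "irl_thm \<phi>"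
  shows "irl_thm \<psi>"
  using irl_thm_replace[OF assms repl.here] by simp

lemma irl_thm_iff_refl: "irl_thm (\<phi> \<^bold>\<leftrightarrow> \<phi>)"
  by (intro irl_thm.ax irl_axiom.intros)

text \<open>In the axiom \<open>\<phi> \<leftrightarrow> \<phi>\<close> only the left occurrence is
  replaced by \<open>\<psi>\<close>.\<close>

lemma irl_thm_iff_sym:
  assumes "irl_thm (\<phi> \<^bold>\<leftrightarrow> \<psi>)"
  shows "irl_thm (\<psi> \<^bold>\<leftrightarrow> \<phi>)"
  using irl_thm_replace[OF assms irl_thm_iff_refl repl.iff[OF repl.here repl.keep]] by simp

lemma irl_thm_iff_trans [trans]:
  assumes "irl_thm (\<phi> \<^bold>\<leftrightarrow> \<psi>)" "irl_thm (\<psi> \<^bold>\<leftrightarrow> \<chi>)"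
  shows "irl_thm (\<phi> \<^bold>\<leftrightarrow> \<chi>)"
  using irl_thm_replace[OF assms(2,1) repl.iff[OF repl.keep repl.here]] by simp

text \<open>Starting from \<open>\<chi> \<leftrightarrow> \<chi>\<close>, the replacement is carried
  out in the right copy alone.\<close>

lemma irl_thm_iff_cong:
  assumes "irl_thm (\<phi> \<^bold>\<leftrightarrow> \<psi>)" "repl \<phi> \<psi> n \<chi> \<chi>'" "n \<ge> 1"
  shows "irl_thm (\<chi> \<^bold>\<leftrightarrow> \<chi>')"
  using irl_thm_replace[OF assms(1) irl_thm_iff_refl repl.iff[OF repl.keep assms(2)]] assms(3)
  by simp

lemma irl_thm_conj_cong2:
  assumes "irl_thm (\<phi> \<^bold>\<leftrightarrow> \<psi>)"
  shows "irl_thm ((\<chi> \<^bold>\<and> \<phi>) \<^bold>\<leftrightarrow> (\<chi> \<^bold>\<and> \<psi>))"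
  using irl_thm_iff_cong[OF assms repl.conj[OF repl.keep repl.here]] by simp

lemma irl_thm_disj_cong2:
  assumes "irl_thm (\<phi> \<^bold>\<leftrightarrow> \<psi>)"
  shows "irl_thm ((\<chi> \<^bold>\<or> \<phi>) \<^bold>\<leftrightarrow> (\<chi> \<^bold>\<or> \<psi>))"
  using irl_thm_iff_cong[OF assms repl.disj[OF repl.keep repl.here]] by simp

text \<open>The axiom for \<open>\<rightarrow>\<close>, read from right to left.\<close>

lemma irl_thm_impI:
  assumes "irl_thm ((\<phi> \<^bold>\<and> \<psi>) \<^bold>\<leftrightarrow> \<phi>)"
  shows "irl_thm (\<phi> \<^bold>\<rightarrow> \<psi>)"
  by (rule irl_thm_iff_mp[OF irl_thm_iff_sym assms]) (intro irl_thm.ax irl_axiom.intros)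

lemma irl_thm_Bot_conj: "irl_thm ((\<^bold>\<bottom> \<^bold>\<and> \<phi>) \<^bold>\<leftrightarrow> \<^bold>\<bottom>)"
proof -
  have contradiction: "irl_thm ((\<phi> \<^bold>\<and> \<^bold>\<not> \<phi>) \<^bold>\<leftrightarrow> \<^bold>\<bottom>)"
    by (intro irl_thm.ax irl_axiom.intros)
  \<comment> \<open>Commuting comes first because the unit axiom has \<open>\<bottom>\<close> as its
    right disjunct.\<close>
  have "irl_thm ((\<^bold>\<bottom> \<^bold>\<or> \<^bold>\<not> \<phi>) \<^bold>\<leftrightarrow> (\<^bold>\<not> \<phi> \<^bold>\<or> \<^bold>\<bottom>))"
    by (intro irl_thm.ax irl_axiom.intros)
  also have "irl_thm ((\<^bold>\<not> \<phi> \<^bold>\<or> \<^bold>\<bottom>) \<^bold>\<leftrightarrow> \<^bold>\<not> \<phi>)"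
    by (intro irl_thm.ax irl_axiom.intros)
  finally have Bot_disj: "irl_thm ((\<^bold>\<bottom> \<^bold>\<or> \<^bold>\<not> \<phi>) \<^bold>\<leftrightarrow> \<^bold>\<not> \<phi>)" .
  have "irl_thm ((\<^bold>\<bottom> \<^bold>\<and> \<phi>) \<^bold>\<leftrightarrow> (\<phi> \<^bold>\<and> \<^bold>\<bottom>))"
    by (intro irl_thm.ax irl_axiom.intros)
  also have "irl_thm ((\<phi> \<^bold>\<and> \<^bold>\<bottom>) \<^bold>\<leftrightarrow> ((\<phi> \<^bold>\<and> \<^bold>\<bottom>) \<^bold>\<or> \<^bold>\<bottom>))"
    by (rule irl_thm_iff_sym) (intro irl_thm.ax irl_axiom.intros)
  \<comment> \<open>Expanding \<open>\<bottom>\<close> as a contradiction in the same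
    \<open>\<phi>\<close> gives both disjuncts the factor \<open>\<phi>\<close>, which
    distributivity can then pull out.\<close>
  also have "irl_thm (((\<phi> \<^bold>\<and> \<^bold>\<bottom>) \<^bold>\<or> \<^bold>\<bottom>) \<^bold>\<leftrightarrow> ((\<phi> \<^bold>\<and> \<^bold>\<bottom>) \<^bold>\<or> (\<phi> \<^bold>\<and> \<^bold>\<not> \<phi>)))"
    by (rule irl_thm_disj_cong2[OF irl_thm_iff_sym[OF contradiction]])
  also have "irl_thm (((\<phi> \<^bold>\<and> \<^bold>\<bottom>) \<^bold>\<or> (\<phi> \<^bold>\<and> \<^bold>\<not> \<phi>)) \<^bold>\<leftrightarrow> (\<phi> \<^bold>\<and> (\<^bold>\<bottom> \<^bold>\<or> \<^bold>\<not> \<phi>)))"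
    by (rule irl_thm_iff_sym) (intro irl_thm.ax irl_axiom.intros)
  also have "irl_thm ((\<phi> \<^bold>\<and> (\<^bold>\<bottom> \<^bold>\<or> \<^bold>\<not> \<phi>)) \<^bold>\<leftrightarrow> (\<phi> \<^bold>\<and> \<^bold>\<not> \<phi>))"
    by (rule irl_thm_conj_cong2[OF Bot_disj])
  also note contradiction
  finally show ?thesis .
qed

theorem theorem3p4p11:
  fixes \<phi> :: "'k::countable fm"
  shows "{} \<turnstile> (\<^bold>\<bottom> \<^bold>\<rightarrow> \<phi>) \<and> {} \<turnstile> (\<phi> \<^bold>\<rightarrow> \<^bold>\<top>)"
proof
  show "{} \<turnstile> (\<^bold>\<bottom> \<^bold>\<rightarrow> \<phi>)"
    unfolding irl_thm_iff[symmetric] by (rule irl_thm_impI[OF irl_thm_Bot_conj])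
  show "{} \<turnstile> (\<phi> \<^bold>\<rightarrow> \<^bold>\<top>)"
    unfolding irl_thm_iff[symmetric] by (rule irl_thm_impI) (intro irl_thm.ax irl_axiom.intros)
qed

end
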